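(* Let $T_1, T_2, \ldots$ be a sequence of tournaments, each of which is strongly connected. Let $\mathcal{P}$ be the set of all tournaments $T$ such that no $T_i$ is isomorphic to an induced sub-tournament of $T$. Then either $\lim_{n\to\infty} |\mathcal{P}_n|^{1/n}$ exists, or $\liminf_{n \to \infty} |\mathcal{P}_n|^{1/n} = \infty$.
   Context: Tournaments are unlabelled; $\mathcal{P}_n$ is the set of members of $\mathcal{P}$ on $n$ vertices. A tournament is strongly connected if for every ordered pair of vertices $u,v$ there is a directed path from $u$ to $v$; equivalently, its vertex set cannot be partitioned into non-empty sets $A,B$ with every vertex of $A$ dominating every vertex of $B$. *)

theory Defs
  imports
    "Graph_Theory.Digraph_Component"
    "Graph_Theory.Digraph_Isomorphism"
    "HOL-Library.Extended_Real"
begin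

locale tournament = pair_digraph G for G :: "'a pair_pre_digraph" +
  assumes exactly_one_arc:
    "\<And>u v. u \<in> pverts G \<Longrightarrow> v \<in> pverts G \<Longrightarrow> u \<noteq> v \<Longrightarrow>
      (u, v) \<in> parcs G \<longleftrightarrow> (v, u) \<notin> parcs G"

text \<open>
  A finite tournament is isomorphic to one whose vertices are natural numbers, so
  a class of tournaments is represented by the set of all its members with
  vertices in \<^typ>\<open>nat\<close>. The forbidden tournaments may live on any vertex type.
\<close>
definition tournaments_avoiding :: "(nat \<Rightarrow> 'a pair_pre_digraph) \<Rightarrow> nat pair_pre_digraph set" where
  "tournaments_avoiding T =
    {G. tournament G \<and>
        (\<forall>i. \<nexists>H. tournament H \<and> induced_subgraph (with_proj H) (with_proj G) \<and>
              digraph_iso (with_proj (T i)) (with_proj H))}"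

definition members_of_size :: "nat pair_pre_digraph set \<Rightarrow> nat \<Rightarrow> nat pair_pre_digraph set" where
  "members_of_size P n = {G \<in> P. card (pverts G) = n}"

definition iso_rel_on :: "'a pair_pre_digraph set \<Rightarrow> 'a pair_pre_digraph rel" where
  "iso_rel_on A = {(G, H). G \<in> A \<and> H \<in> A \<and> digraph_iso (with_proj G) (with_proj H)}"

definition unlabelled_count :: "nat pair_pre_digraph set \<Rightarrow> nat \<Rightarrow> nat" where
  "unlabelled_count P n = card (members_of_size P n // iso_rel_on (members_of_size P n))"

lemma digraph_iso_with_proj_iff:
  assumes "pair_wf_digraph G" "pair_wf_digraph H"
  shows "digraph_iso (with_proj G) (with_proj H) \<longleftrightarrow>
    (\<exists>f. bij_betw f (pverts G) (pverts H) \<and>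
         (\<forall>u\<in>pverts G. \<forall>v\<in>pverts G. (u, v) \<in> parcs G \<longleftrightarrow> (f u, f v) \<in> parcs H))"
    (is "?L \<longleftrightarrow> ?R")
proof
  interpret G: pair_wf_digraph G by fact
  interpret H: pair_wf_digraph H by fact
  {
    assume ?L
    then obtain h where h: "pre_digraph.digraph_isomorphism (with_proj G) h"
      and eq: "with_proj H = app_iso h (with_proj G)"
      unfolding digraph_iso_def by blast
    have V: "pverts H = iso_verts h ` pverts G" and A: "parcs H = iso_arcs h ` parcs G"
      and T: "iso_tail h = fst" and D: "iso_head h = snd"
      using arg_cong[OF eq, of verts] arg_cong[OF eq, of arcs]
        arg_cong[OF eq, of tail] arg_cong[OF eq, of head] by simp_all
    have inj: "inj_on (iso_verts h) (pverts G)"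
      using h by (simp add: pre_digraph.digraph_isomorphism_def)
    have arc: "iso_arcs h e = (iso_verts h (fst e), iso_verts h (snd e))" if "e \<in> parcs G" for e
      using h that by (auto simp: pre_digraph.digraph_isomorphism_def T D prod_eq_iff)
    have "(u, v) \<in> parcs G \<longleftrightarrow> (iso_verts h u, iso_verts h v) \<in> parcs H"
      if "u \<in> pverts G" "v \<in> pverts G" for u v
    proof
      assume "(u, v) \<in> parcs G"
      then show "(iso_verts h u, iso_verts h v) \<in> parcs H"
        using arc[of "(u, v)"] unfolding A by (metis fst_conv imageI snd_conv)
    next
      assume "(iso_verts h u, iso_verts h v) \<in> parcs H"
      then obtain x y where xy: "(x, y) \<in> parcs G"
        and "(iso_verts h u, iso_verts h v) = iso_arcs h (x, y)"
        unfolding A by auto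
      then have "iso_verts h u = iso_verts h x" "iso_verts h v = iso_verts h y"
        using arc[OF xy] by simp_all
      then show "(u, v) \<in> parcs G"
        using inj that xy G.in_arcsD1[OF xy] G.in_arcsD2[OF xy] by (metis inj_onD)
    qed
    then show ?R
      using inj V by (intro exI[of _ "iso_verts h"]) (auto simp: bij_betw_def)
  next
    assume ?R
    then obtain f where bij: "bij_betw f (pverts G) (pverts H)"
      and f: "\<And>u v. u \<in> pverts G \<Longrightarrow> v \<in> pverts G \<Longrightarrow> (u, v) \<in> parcs G \<longleftrightarrow> (f u, f v) \<in> parcs H"
      by blast
    let ?h = "\<lparr> iso_verts = f, iso_arcs = map_prod f f, iso_head = snd, iso_tail = fst \<rparr>"
    have inj: "inj_on f (pverts G)" and im: "f ` pverts G = pverts H"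
      using bij by (auto simp: bij_betw_def)
    have "inj_on (map_prod f f) (parcs G)"
    proof (rule inj_onI)
      fix a b assume ab: "a \<in> parcs G" "b \<in> parcs G" "map_prod f f a = map_prod f f b"
      then have "f (fst a) = f (fst b)" "f (snd a) = f (snd b)"
        by (metis fst_map_prod) (metis ab(3) snd_map_prod)
      then show "a = b"
        using inj ab G.arc_fst_in_verts G.arc_snd_in_verts by (metis inj_onD prod_eqI)
    qed
    then have iso: "pre_digraph.digraph_isomorphism (with_proj G) ?h"
      using inj G.wf_digraph by (simp add: pre_digraph.digraph_isomorphism_def)
    have "map_prod f f ` parcs G = parcs H"
    proof (intro set_eqI iffI)
      fix e assume "e \<in> map_prod f f ` parcs G"
      then obtain u v where "(u, v) \<in> parcs G" "e = (f u, f v)" by auto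
      then show "e \<in> parcs H" using f G.in_arcsD1 G.in_arcsD2 by blast
    next
      fix e assume e: "e \<in> parcs H"
      then have "fst e \<in> f ` pverts G" "snd e \<in> f ` pverts G"
        using im H.arc_fst_in_verts H.arc_snd_in_verts by auto
      then obtain u v where uv: "u \<in> pverts G" "v \<in> pverts G" "fst e = f u" "snd e = f v" by auto
      then have "e = map_prod f f (u, v)" by (simp add: prod_eq_iff)
      moreover have "(u, v) \<in> parcs G" using e f uv by (metis prod.collapse)
      ultimately show "e \<in> map_prod f f ` parcs G" by blast
    qed
    then have "with_proj H = app_iso ?h (with_proj G)"
      using im by (simp add: with_proj_def app_iso_def)
    then show ?L using iso unfolding digraph_iso_def by blast
  }
qed

lemma equiv_iso_rel_on:
  assumes "\<And>G. G \<in> A \<Longrightarrow> pair_wf_digraph G"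
  shows "equiv A (iso_rel_on A)"
proof (rule equivI)
  have "digraph_iso (with_proj G) (with_proj G)" if "G \<in> A" for G
    using assms[OF that] by (subst digraph_iso_with_proj_iff) (auto intro: exI[of _ id])
  then show "refl_on A (iso_rel_on A)" by (auto simp: refl_on_def iso_rel_on_def)
  have wf: "wf_digraph (with_proj G)" if "G \<in> A" for G
  proof -
    interpret pair_wf_digraph G using assms[OF that] .
    show ?thesis by (rule wf_digraph)
  qed
  show "iso_rel_on A \<subseteq> A \<times> A" by (auto simp: iso_rel_on_def)
  show "sym (iso_rel_on A)" by (auto simp: sym_def iso_rel_on_def intro: digraph_iso_swap wf)
  show "trans (iso_rel_on A)" by (auto simp: trans_def iso_rel_on_def intro: digraph_iso_trans)
qed

lemma finite_iso_classes:
  fixes P :: "nat pair_pre_digraph set"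
  assumes "\<And>G. G \<in> P \<Longrightarrow> tournament G"
  shows "finite (members_of_size P n // iso_rel_on (members_of_size P n))"
proof -
  let ?A = "members_of_size P n" and ?R = "iso_rel_on (members_of_size P n)"
  let ?S = "Pow ({..<n} \<times> {..<n})"
  have wf: "pair_wf_digraph G" if "G \<in> ?A" for G
    using assms that unfolding members_of_size_def tournament_def pair_digraph_def
      pair_fin_digraph_def by blast
  have eqv: "equiv ?A ?R" by (rule equiv_iso_rel_on) (rule wf)
  have "\<exists>S\<in>?S. digraph_iso (with_proj G) (with_proj \<lparr> pverts = {..<n}, parcs = S \<rparr>)"
    if G: "G \<in> ?A" for G
  proof -
    interpret tournament G using assms G by (simp add: members_of_size_def)
    obtain f where f: "bij_betw f (pverts G) {..<n}"
      using G ex_bij_betw_finite_nat[OF pair_finite_verts]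
      by (auto simp: members_of_size_def atLeast0LessThan)
    let ?p = "map_prod f f ` parcs G"
    have sub: "?p \<subseteq> {..<n} \<times> {..<n}"
    proof
      fix e assume "e \<in> ?p"
      then obtain u v where uv: "(u, v) \<in> parcs G" "e = (f u, f v)" by auto
      then show "e \<in> {..<n} \<times> {..<n}"
        using bij_betwE[OF f] in_arcsD1[OF uv(1)] in_arcsD2[OF uv(1)] by simp
    qed
    moreover have "pair_wf_digraph \<lparr> pverts = {..<n}, parcs = ?p \<rparr>"
      using sub by unfold_locales (auto dest!: subsetD[OF sub])
    moreover have "(u, v) \<in> parcs G \<longleftrightarrow> (f u, f v) \<in> ?p"
      if "u \<in> pverts G" "v \<in> pverts G" for u v
    proof
      assume "(f u, f v) \<in> ?p"
      then obtain x y where xy: "(x, y) \<in> parcs G" "f u = f x" "f v = f y" by auto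
      then show "(u, v) \<in> parcs G"
        using f that in_arcsD1[OF xy(1)] in_arcsD2[OF xy(1)] by (metis bij_betw_def inj_onD)
    qed (rule image_eqI, simp_all)
    ultimately have "digraph_iso (with_proj G) (with_proj \<lparr> pverts = {..<n}, parcs = ?p \<rparr>)"
      using f by (subst digraph_iso_with_proj_iff[OF wf[OF G]]) (simp, intro exI[of _ f], simp)
    then show ?thesis using sub by blast
  qed
  then obtain c where c: "\<And>G. G \<in> ?A \<Longrightarrow> c G \<in> ?S"
    "\<And>G. G \<in> ?A \<Longrightarrow> digraph_iso (with_proj G) (with_proj \<lparr> pverts = {..<n}, parcs = c G \<rparr>)"
    by metis
  have same: "(G, H) \<in> ?R" if "G \<in> ?A" "H \<in> ?A" "c G = c H" for G H
  proof -
    interpret pair_wf_digraph H using wf that(2) .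
    have "digraph_iso (with_proj \<lparr> pverts = {..<n}, parcs = c G \<rparr>) (with_proj H)"
      using c(2)[OF that(2)] that(3) by (metis digraph_iso_swap wf_digraph)
    then show ?thesis
      using that c(2)[OF that(1)] by (auto simp: iso_rel_on_def intro: digraph_iso_trans)
  qed
  define g where "g S = ?R `` {SOME G. G \<in> ?A \<and> c G = S}" for S
  have "?A // ?R \<subseteq> g ` ?S"
  proof
    fix X assume "X \<in> ?A // ?R"
    then obtain G where G: "G \<in> ?A" "X = ?R `` {G}" by (auto elim: quotientE)
    let ?G' = "SOME G'. G' \<in> ?A \<and> c G' = c G"
    have "?G' \<in> ?A \<and> c ?G' = c G" by (rule someI[of _ G]) (use G in simp)
    then have "(?G', G) \<in> ?R" by (intro same) (use G in auto)
    then have "g (c G) = X" using G eqv by (simp add: g_def equiv_class_eq)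
    then show "X \<in> g ` ?S" using c(1)[OF G(1)] by blast
  qed
  then show ?thesis by (rule finite_subset) simp
qed

end

theory Submission
  imports Defs
begin

text \<open>
  Placing a tournament \<open>G\<close> before a tournament \<open>H\<close>, with every vertex of \<open>G\<close> dominating every
  vertex of \<open>H\<close>, creates no new strongly connected sub-tournaments, so the class is closed under
  this ordered sum. The sum and the order of \<open>G\<close> determine \<open>G\<close> and \<open>H\<close> up to isomorphism, since a
  tournament has at most one set of given size dominating its complement. Hence
  \<open>|P\<^sub>m| |P\<^sub>n| \<le> |P\<^sub>m\<^sub>+\<^sub>n|\<close>, and Fekete's lemma applies to the logarithms, unless the
  one-vertex tournament is forbidden, in which case the class has only the empty member.
\<close>

subsection \<open>Fekete's lemma\<close>

text \<open>Stated with a remainder term, so that division of an index by \<open>m\<close> gives a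
  lower bound for \<open>b\<close> at that index.\<close>

lemma superadditive_mult:
  fixes b :: "nat \<Rightarrow> real"
  assumes "\<And>m n. b m + b n \<le> b (m + n)"
  shows "real q * b m + b r \<le> b (q * m + r)"
proof (induction q)
  case (Suc q)
  have "real (Suc q) * b m + b r \<le> b m + b (q * m + r)"
    using Suc by (simp add: algebra_simps)
  also have "\<dots> \<le> b (Suc q * m + r)"
    using assms[of m "q * m + r"] by (simp add: algebra_simps)
  finally show ?case .
qed simp

text \<open>Squeezed by n - m \<le> m * (n div m) \<le> n, divided by m * n.\<close>

lemma div_quotient_tendsto:
  assumes "m > 0"
  shows "(\<lambda>n. real (n div m) / real n) \<longlonglongrightarrow> 1 / real m"
proof (rule tendsto_sandwich)
  show "\<forall>\<^sub>F n in sequentially. 1 / real m - 1 / real n \<le> real (n div m) / real n"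
    using eventually_gt_at_top[of 0]
  proof eventually_elim
    case (elim n)
    have "n \<le> m * (n div m) + m"
      using assms by (metis add_left_mono less_imp_le mod_less_divisor mult_div_mod_eq)
    then have "real n \<le> real m * real (n div m) + real m"
      by (metis of_nat_add of_nat_le_iff of_nat_mult)
    from mult_left_mono[OF this, of "real n"] show ?case
      using elim assms by (simp add: field_simps)
  qed
  show "\<forall>\<^sub>F n in sequentially. real (n div m) / real n \<le> 1 / real m"
    using eventually_gt_at_top[of 0]
  proof eventually_elim
    case (elim n)
    have "real m * real (n div m) \<le> real n"
      by (metis of_nat_le_iff of_nat_mult times_div_less_eq_dividend)
    then show ?case using elim assms by (simp add: field_simps)
  qed
  show "(\<lambda>n. 1 / real m - 1 / real n) \<longlonglongrightarrow> 1 / real m"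
    using tendsto_diff[OF tendsto_const lim_1_over_n, of "1 / real m"] by simp
qed simp

text \<open>Fekete's argument: if x lies below the supremum, some quotient at an index
  \<open>m\<close> exceeds x, and writing n as a multiple of \<open>m\<close> plus a remainder
  carries this bound to all large n. The supremum is taken in \<open>ereal\<close> to cover
  unbounded quotients, and starts at 1 because division by zero would contribute the spurious value
  0.\<close>

lemma superadditive_tendsto_SUP:
  fixes b :: "nat \<Rightarrow> real"
  assumes super: "\<And>m n. b m + b n \<le> b (m + n)"
  shows "(\<lambda>n. ereal (b n / real n)) \<longlonglongrightarrow> (SUP n\<in>{1..}. ereal (b n / real n))"
proof (rule order_tendstoI)
  fix x assume "x < (SUP n\<in>{1..}. ereal (b n / real n))"
  then obtain m where m: "m \<ge> 1" "x < ereal (b m / real m)"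
    by (auto simp: less_SUP_iff)
  \<comment> \<open>A bound for the remainder term \<open>b (n mod m)\<close> that is uniform in n;
    after division by n its contribution tends to 0.\<close>
  define c where "c = Min (b ` {..<m})"
  define l where "l n = real (n div m) / real n * b m + c * (1 / real n)" for n
  have le: "l n \<le> b n / real n" if "n > 0" for n
  proof -
    have "c \<le> b (n mod m)" using m by (auto simp: c_def)
    then have "real (n div m) * b m + c \<le> b n"
      using superadditive_mult[OF super, of "n div m" m "n mod m"] by simp
    then have "(real (n div m) * b m + c) / real n \<le> b n / real n"
      by (intro divide_right_mono) auto
    then show ?thesis by (simp add: l_def add_divide_distrib)
  qed
  have "l \<longlonglongrightarrow> 1 / real m * b m + c * 0"
    unfolding l_def
    by (intro tendsto_add tendsto_mult tendsto_const div_quotient_tendsto lim_1_over_n) (use m in auto)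
  then have "(\<lambda>n. ereal (l n)) \<longlonglongrightarrow> ereal (b m / real m)" by simp
  then have "\<forall>\<^sub>F n in sequentially. x < ereal (l n)"
    using m(2) by (rule order_tendstoD)
  then show "\<forall>\<^sub>F n in sequentially. x < ereal (b n / real n)"
    using eventually_gt_at_top[of 0]
  proof eventually_elim
    case (elim n)
    have "ereal (l n) \<le> ereal (b n / real n)" using le elim(2) by simp
    with elim(1) show ?case by (rule less_le_trans)
  qed
next
  fix x assume x: "(SUP n\<in>{1..}. ereal (b n / real n)) < x"
  show "\<forall>\<^sub>F n in sequentially. ereal (b n / real n) < x"
    using eventually_ge_at_top[of 1]
  proof eventually_elim
    case (elim n)
    have "ereal (b n / real n) \<le> (SUP n\<in>{1..}. ereal (b n / real n))"
      by (rule SUP_upper) (use elim in simp)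
    then show ?case using x by (rule le_less_trans)
  qed
qed

text \<open>Logarithms turn supermultiplicativity into superadditivity. The two alternatives
  correspond to a finite or an infinite supremum of \<open>q\<close>.\<close>

lemma supermultiplicative_root_limit:
  fixes a :: "nat \<Rightarrow> real"
  assumes pos: "\<And>n. a n > 0" and super: "\<And>m n. a m * a n \<le> a (m + n)"
  shows "convergent (\<lambda>n. root n (a n)) \<or> liminf (\<lambda>n. ereal (root n (a n))) = \<infinity>"
proof -
  define q where "q n = ln (a n) / real n" for n
  let ?S = "SUP n\<in>{1..}. ereal (q n)"
  \<comment> \<open>This fails at n = 0, where \<open>root 0\<close> is 0 but
    \<open>exp (q 0)\<close> is 1; limits only see the tail.\<close>
  have root: "\<forall>\<^sub>F n in sequentially. exp (q n) = root n (a n)"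
    using eventually_gt_at_top[of 0]
  proof eventually_elim
    case (elim n)
    then show ?case
      using pos[of n] by (simp add: q_def root_powr_inverse powr_def)
  qed
  have lim: "(\<lambda>n. ereal (q n)) \<longlonglongrightarrow> ?S"
    unfolding q_def
  proof (rule superadditive_tendsto_SUP)
    show "ln (a m) + ln (a n) \<le> ln (a (m + n))" for m n
      using super[of m n] pos[of m] pos[of n] by (metis ln_mult_pos ln_mono mult_pos_pos)
  qed
  show ?thesis
  proof (cases ?S)
    case (real l)
    then have "q \<longlonglongrightarrow> l" using lim by simp
    then have "(\<lambda>n. exp (q n)) \<longlonglongrightarrow> exp l" by (rule tendsto_exp)
    then have "(\<lambda>n. root n (a n)) \<longlonglongrightarrow> exp l"
      unfolding tendsto_cong[OF root] .
    then show ?thesis by (auto simp: convergent_def)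
  next
    case PInf
    then have "filterlim q at_top sequentially"
      using lim by (simp add: tendsto_PInfty_eq_at_top)
    then have "filterlim (\<lambda>n. exp (q n)) at_top sequentially"
      by (rule filterlim_compose[OF exp_at_top])
    then have "filterlim (\<lambda>n. root n (a n)) at_top sequentially"
      unfolding filterlim_cong[OF refl refl root] .
    then have "(\<lambda>n. ereal (root n (a n))) \<longlonglongrightarrow> \<infinity>"
      by (simp add: tendsto_PInfty_eq_at_top)
    then show ?thesis by (simp add: lim_imp_Liminf)
  next
    case MInf
    moreover have "ereal (q 1) \<le> ?S" by (rule SUP_upper) simp
    ultimately show ?thesis by simp
  qed
qed

subsection \<open>Embeddings and ordered sums of tournaments\<close>

lemma tournamentD:
  assumes "tournament G"
  shows tournament_finite: "finite (pverts G)"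
    and tournament_arcs: "parcs G \<subseteq> pverts G \<times> pverts G"
    and tournament_irrefl: "(u, u) \<notin> parcs G"
    and tournament_arc_iff: "\<lbrakk>u \<in> pverts G; v \<in> pverts G; u \<noteq> v\<rbrakk> \<Longrightarrow> (u, v) \<in> parcs G \<longleftrightarrow> (v, u) \<notin> parcs G"
proof -
  interpret tournament G by fact
  show "finite (pverts G)" by (rule pair_finite_verts)
  show "parcs G \<subseteq> pverts G \<times> pverts G" using in_arcsD1 in_arcsD2 by auto
  show "(u, u) \<notin> parcs G" using no_loops' by blast
  show "\<lbrakk>u \<in> pverts G; v \<in> pverts G; u \<noteq> v\<rbrakk> \<Longrightarrow> (u, v) \<in> parcs G \<longleftrightarrow> (v, u) \<notin> parcs G"
    by (rule exactly_one_arc)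
qed

lemma tournamentI:
  assumes "finite (pverts G)" "parcs G \<subseteq> pverts G \<times> pverts G"
    and "\<And>u. u \<in> pverts G \<Longrightarrow> (u, u) \<notin> parcs G"
    and "\<And>u v. \<lbrakk>u \<in> pverts G; v \<in> pverts G; u \<noteq> v\<rbrakk> \<Longrightarrow> (u, v) \<in> parcs G \<longleftrightarrow> (v, u) \<notin> parcs G"
  shows "tournament G"
proof
  show "finite (parcs G)"
    using assms(1,2) by (metis finite_SigmaI finite_subset)
  show "fst e \<in> pverts G" "snd e \<in> pverts G" if "e \<in> parcs G" for e
    using assms(2) that by auto
  then show "fst e \<noteq> snd e" if "e \<in> parcs G" for e
    using assms(3) that by (metis prod.collapse)
qed (use assms(1,4) in blast)+

lemma tournament_pair_wf: "tournament G \<Longrightarrow> pair_wf_digraph G"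
  by (simp add: tournament_def pair_digraph_def pair_fin_digraph_def)

text \<open>Containment of an isomorphic copy, phrased by a vertex map alone; the equivalence
  between arcs makes the copy induced.\<close>

definition embeds :: "'a pair_pre_digraph \<Rightarrow> 'b pair_pre_digraph \<Rightarrow> bool" where
  "embeds T G \<longleftrightarrow> (\<exists>f. inj_on f (pverts T) \<and> f ` pverts T \<subseteq> pverts G \<and>
     (\<forall>u\<in>pverts T. \<forall>v\<in>pverts T. (u, v) \<in> parcs T \<longleftrightarrow> (f u, f v) \<in> parcs G))"

definition pisomorphic :: "'a pair_pre_digraph \<Rightarrow> 'b pair_pre_digraph \<Rightarrow> bool" where
  "pisomorphic G H \<longleftrightarrow> (\<exists>f. bij_betw f (pverts G) (pverts H) \<and>
     (\<forall>u\<in>pverts G. \<forall>v\<in>pverts G. (u, v) \<in> parcs G \<longleftrightarrow> (f u, f v) \<in> parcs H))"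

lemma digraph_iso_iff_pisomorphic:
  "tournament G \<Longrightarrow> tournament H \<Longrightarrow> digraph_iso (with_proj G) (with_proj H) \<longleftrightarrow> pisomorphic G H"
  unfolding pisomorphic_def by (intro digraph_iso_with_proj_iff tournament_pair_wf)

section \<open>Embeddings and induced sub-tournaments\<close>

lemma induced_subgraph_with_proj_iff:
  assumes "tournament G" "tournament H"
  shows "induced_subgraph (with_proj H) (with_proj G) \<longleftrightarrow>
    pverts H \<subseteq> pverts G \<and> parcs H = parcs G \<inter> pverts H \<times> pverts H"
  using assms[THEN tournament_pair_wf]
  by (auto simp: induced_subgraph_def subgraph_def compatible_def wf_digraph_wp_iff)

text \<open>The image of an embedding spans the required sub-tournament; conversely, an isomorphism
  onto \<open>H\<close> is already an embedding into \<open>G\<close>.\<close>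

lemma embeds_iff_induced_subgraph:
  fixes T :: "'a pair_pre_digraph" and G :: "'b pair_pre_digraph"
  assumes T: "tournament T" and G: "tournament G"
  shows "embeds T G \<longleftrightarrow> (\<exists>H. tournament H \<and> induced_subgraph (with_proj H) (with_proj G) \<and> pisomorphic T H)"
proof
  assume "embeds T G"
  then obtain f where f: "inj_on f (pverts T)" "f ` pverts T \<subseteq> pverts G"
    "\<And>u v. u \<in> pverts T \<Longrightarrow> v \<in> pverts T \<Longrightarrow> (u, v) \<in> parcs T \<longleftrightarrow> (f u, f v) \<in> parcs G"
    unfolding embeds_def by blast
  define H where "H = \<lparr>pverts = f ` pverts T, parcs = parcs G \<inter> f ` pverts T \<times> f ` pverts T\<rparr>"
  have sub: "pverts H \<subseteq> pverts G" using f(2) by (simp add: H_def)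
  have arc: "(u, v) \<in> parcs H \<longleftrightarrow> (u, v) \<in> parcs G \<and> u \<in> pverts H \<and> v \<in> pverts H" for u v
    by (simp add: H_def)
  have H: "tournament H"
  proof (rule tournamentI)
    show "finite (pverts H)" using tournament_finite[OF T] by (simp add: H_def)
    show "parcs H \<subseteq> pverts H \<times> pverts H" by (auto simp: H_def)
  qed (use tournament_irrefl[OF G] tournament_arc_iff[OF G] sub arc in blast)+
  have "induced_subgraph (with_proj H) (with_proj G)"
    using f(2) by (simp add: induced_subgraph_with_proj_iff G H) (simp add: H_def)
  moreover have "pisomorphic T H"
    unfolding pisomorphic_def H_def
    by (intro exI[of _ f]) (use f in \<open>auto simp: bij_betw_def\<close>)
  ultimately show "\<exists>H. tournament H \<and> induced_subgraph (with_proj H) (with_proj G) \<and> pisomorphic T H"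
    using H by blast
next
  assume "\<exists>H. tournament H \<and> induced_subgraph (with_proj H) (with_proj G) \<and> pisomorphic T H"
  then obtain H f where H: "tournament H" "induced_subgraph (with_proj H) (with_proj G)"
    and f: "bij_betw f (pverts T) (pverts H)"
      "\<And>u v. u \<in> pverts T \<Longrightarrow> v \<in> pverts T \<Longrightarrow> (u, v) \<in> parcs T \<longleftrightarrow> (f u, f v) \<in> parcs H"
    unfolding pisomorphic_def by blast
  then show "embeds T G"
    using G unfolding embeds_def induced_subgraph_with_proj_iff[OF G H(1)]
    by (intro exI[of _ f]) (auto simp: bij_betw_def)
qed

lemma tournaments_avoiding_iff:
  assumes "\<And>i. tournament (T i)"
  shows "G \<in> tournaments_avoiding T \<longleftrightarrow> tournament G \<and> (\<forall>i. \<not> embeds (T i) G)"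
proof -
  have "embeds (T i) G \<longleftrightarrow> (\<exists>H. tournament H \<and> induced_subgraph (with_proj H) (with_proj G) \<and>
      digraph_iso (with_proj (T i)) (with_proj H))" if "tournament G" for i
    unfolding embeds_iff_induced_subgraph[OF assms that]
    using digraph_iso_iff_pisomorphic[OF assms] by blast
  then show ?thesis unfolding tournaments_avoiding_def by blast
qed

text \<open>Parity keeps the two copies disjoint inside \<open>nat\<close>: a vertex v of
  \<open>G\<close> becomes 2 * v, a vertex v of \<open>H\<close> becomes 2 * v + 1. Arcs between the
  copies all run from even to odd.\<close>

definition ordered_sum :: "nat pair_pre_digraph \<Rightarrow> nat pair_pre_digraph \<Rightarrow> nat pair_pre_digraph" where
  "ordered_sum G H = \<lparr>
     pverts = {v. v div 2 \<in> pverts (if even v then G else H)},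
     parcs = {(u, v). if even u = even v
       then (u div 2, v div 2) \<in> parcs (if even u then G else H)
       else even u \<and> u div 2 \<in> pverts G \<and> v div 2 \<in> pverts H}\<rparr>"

lemma pverts_ordered_sum:
  "pverts (ordered_sum G H) = (\<lambda>v. 2 * v) ` pverts G \<union> (\<lambda>v. 2 * v + 1) ` pverts H"
proof (intro set_eqI iffI)
  fix v assume v: "v \<in> pverts (ordered_sum G H)"
  show "v \<in> (\<lambda>v. 2 * v) ` pverts G \<union> (\<lambda>v. 2 * v + 1) ` pverts H"
  proof (cases "even v")
    case True
    then show ?thesis
      using v by (intro UnI1 image_eqI[of _ _ "v div 2"]) (simp_all add: ordered_sum_def)
  next
    case False
    then show ?thesis
      using v by (intro UnI2 image_eqI[of _ _ "v div 2"]) (simp_all add: ordered_sum_def)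
  qed
qed (auto simp: ordered_sum_def)

lemma card_pverts_ordered_sum:
  assumes "finite (pverts G)" "finite (pverts H)"
  shows "card (pverts (ordered_sum G H)) = card (pverts G) + card (pverts H)"
proof -
  have "(\<lambda>v. 2 * v) ` pverts G \<inter> (\<lambda>v. 2 * v + 1) ` pverts H = {}"
    by auto presburger
  then show ?thesis
    using assms by (simp add: pverts_ordered_sum card_Un_disjoint card_image inj_on_def)
qed

lemma tournament_ordered_sum:
  assumes G: "tournament G" and H: "tournament H"
  shows "tournament (ordered_sum G H)"
proof (rule tournamentI)
  show "finite (pverts (ordered_sum G H))"
    using assms by (simp add: pverts_ordered_sum tournament_finite)
  show "parcs (ordered_sum G H) \<subseteq> pverts (ordered_sum G H) \<times> pverts (ordered_sum G H)"
    using assms[THEN tournament_arcs] by (auto simp: ordered_sum_def split: if_splits)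
  show "(u, u) \<notin> parcs (ordered_sum G H)" for u
    using assms by (simp add: ordered_sum_def tournament_irrefl)
  fix u v assume uv: "u \<in> pverts (ordered_sum G H)" "v \<in> pverts (ordered_sum G H)" "u \<noteq> v"
  show "(u, v) \<in> parcs (ordered_sum G H) \<longleftrightarrow> (v, u) \<notin> parcs (ordered_sum G H)"
  proof (cases "even u = even v")
    case True
    let ?K = "if even u then G else H"
    have "u div 2 \<noteq> v div 2" using True uv(3) by presburger
    moreover have "u div 2 \<in> pverts ?K" "v div 2 \<in> pverts ?K"
      using True uv by (simp_all add: ordered_sum_def)
    moreover have "tournament ?K" using assms by simp
    ultimately have "(u div 2, v div 2) \<in> parcs ?K \<longleftrightarrow> (v div 2, u div 2) \<notin> parcs ?K"
      using tournament_arc_iff by metis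
    then show ?thesis using True by (simp add: ordered_sum_def)
  next
    case False
    then show ?thesis using uv by (auto simp: ordered_sum_def)
  qed
qed

text \<open>No arc of the sum runs from odd to even, so the image of a directed path cannot leave
  the odd copy. Since any two vertices of \<open>T\<close> are joined by paths in both directions,
  the whole image lies in one copy, and halving moves it into the summand.\<close>

lemma embeds_ordered_sum_cases:
  assumes T: "strongly_connected (with_proj T)"
    and emb: "embeds T (ordered_sum G H)"
  shows "embeds T G \<or> embeds T H"
proof -
  obtain f where f: "inj_on f (pverts T)" "f ` pverts T \<subseteq> pverts (ordered_sum G H)"
    "\<And>u v. u \<in> pverts T \<Longrightarrow> v \<in> pverts T \<Longrightarrow> (u, v) \<in> parcs T \<longleftrightarrow> (f u, f v) \<in> parcs (ordered_sum G H)"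
    using emb unfolding embeds_def by blast
  have same_parity: "even (f u) = even (f v)" if uv: "u \<in> pverts T" "v \<in> pverts T" for u v
  proof -
    have odd_stays: "odd (f y)" if "(x, y) \<in> rtrancl_on (pverts T) (parcs T)" "odd (f x)" for x y
      using that
    proof induction
      case (step y z)
      then have "(f y, f z) \<in> parcs (ordered_sum G H)" using f(3) by blast
      then show ?case using step by (auto simp: ordered_sum_def split: if_splits)
    qed
    have "(u, v) \<in> rtrancl_on (pverts T) (parcs T)" "(v, u) \<in> rtrancl_on (pverts T) (parcs T)"
      using T uv by (auto simp: strongly_connected_def reachable_def)
    then show ?thesis using odd_stays by blast
  qed
  obtain p where p: "\<And>u. u \<in> pverts T \<Longrightarrow> even (f u) = p"
    using same_parity by metis
  have "embeds T (if p then G else H)"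
    unfolding embeds_def
  proof (intro exI[of _ "\<lambda>u. f u div 2"] conjI ballI)
    show "inj_on (\<lambda>u. f u div 2) (pverts T)"
    proof (rule inj_onI)
      fix u v assume uv: "u \<in> pverts T" "v \<in> pverts T" "f u div 2 = f v div 2"
      then have "even (f u) = even (f v)" using p by simp
      with uv(3) have "f u = f v" by presburger
      then show "u = v" using f(1) uv by (simp add: inj_on_def)
    qed
    show "(\<lambda>u. f u div 2) ` pverts T \<subseteq> pverts (if p then G else H)"
      using f(2) p by (auto simp: ordered_sum_def)
    show "(u, v) \<in> parcs T \<longleftrightarrow> (f u div 2, f v div 2) \<in> parcs (if p then G else H)"
      if "u \<in> pverts T" "v \<in> pverts T" for u v
      using f(3)[OF that] p that by (simp add: ordered_sum_def)
  qed
  then show ?thesis by (simp split: if_splits)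
qed

section \<open>Recovering the summands from an ordered sum\<close>

lemma bij_betw_even_vertices:
  "bij_betw (\<lambda>v. 2 * v) (pverts G) {v \<in> pverts (ordered_sum G H). even v}"
  "bij_betw (\<lambda>v. v div 2) {v \<in> pverts (ordered_sum G H). even v} (pverts G)"
proof -
  show "bij_betw (\<lambda>v. 2 * v) (pverts G) {v \<in> pverts (ordered_sum G H). even v}"
    by (rule bij_betwI[where g = "\<lambda>v. v div 2"]) (auto simp: ordered_sum_def)
  show "bij_betw (\<lambda>v. v div 2) {v \<in> pverts (ordered_sum G H). even v} (pverts G)"
    by (rule bij_betwI[where g = "\<lambda>v. 2 * v"]) (auto simp: ordered_sum_def)
qed

lemma bij_betw_odd_vertices:
  "bij_betw (\<lambda>v. 2 * v + 1) (pverts H) {v \<in> pverts (ordered_sum G H). odd v}"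
  "bij_betw (\<lambda>v. v div 2) {v \<in> pverts (ordered_sum G H). odd v} (pverts H)"
proof -
  show "bij_betw (\<lambda>v. 2 * v + 1) (pverts H) {v \<in> pverts (ordered_sum G H). odd v}"
    by (rule bij_betwI[where g = "\<lambda>v. v div 2"]) (auto simp: ordered_sum_def)
  show "bij_betw (\<lambda>v. v div 2) {v \<in> pverts (ordered_sum G H). odd v} (pverts H)"
    by (rule bij_betwI[where g = "\<lambda>v. 2 * v + 1"]) (auto simp: ordered_sum_def)
qed

text \<open>The even vertices of a sum dominate all the others, and an isomorphism preserves this.
  Sets that dominate their complements are nested, so equal sizes force the isomorphism to map even
  vertices onto even vertices; it then splits into isomorphisms of the summands.\<close>

lemma pisomorphic_ordered_sumD:
  assumes fin: "finite (pverts G)" "finite (pverts G')"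
    and card: "card (pverts G) = card (pverts G')"
    and iso: "pisomorphic (ordered_sum G H) (ordered_sum G' H')"
  shows "pisomorphic G G' \<and> pisomorphic H H'"
proof -
  let ?S = "ordered_sum G H" and ?S' = "ordered_sum G' H'"
  obtain f where f: "bij_betw f (pverts ?S) (pverts ?S')"
    and arc: "\<And>u v. u \<in> pverts ?S \<Longrightarrow> v \<in> pverts ?S \<Longrightarrow> (u, v) \<in> parcs ?S \<longleftrightarrow> (f u, f v) \<in> parcs ?S'"
    using iso unfolding pisomorphic_def by blast
  define E where "E = {v \<in> pverts ?S. even v}"
  define E' where "E' = {v \<in> pverts ?S'. even v}"
  have sub: "E \<subseteq> pverts ?S" "E' \<subseteq> pverts ?S'" by (auto simp: E_def E'_def)
  have odds: "pverts ?S - E = {v \<in> pverts ?S. odd v}" "pverts ?S' - E' = {v \<in> pverts ?S'. odd v}"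
    by (auto simp: E_def E'_def)
  have inj: "inj_on f (pverts ?S)" and im: "f ` pverts ?S = pverts ?S'"
    using f by (simp_all add: bij_betw_def)
  \<comment> \<open>Otherwise some \<open>x\<close> in \<open>E\<close> has \<open>f x\<close> odd,
    and some even \<open>y\<close> equals \<open>f z\<close> with \<open>z\<close> odd. The arc from
    \<open>x\<close> to \<open>z\<close> would be mapped to an arc from odd to even.\<close>
  have "f ` E \<subseteq> E' \<or> E' \<subseteq> f ` E"
  proof (rule ccontr)
    assume "\<not> ?thesis"
    then obtain x y where xy: "x \<in> E" "f x \<notin> E'" "y \<in> E'" "y \<notin> f ` E" by blast
    then have "y \<in> f ` pverts ?S" using sub(2) im by blast
    then obtain z where z: "z \<in> pverts ?S" "y = f z" by blast
    then have "odd z" using xy(4) by (auto simp: E_def)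
    then have "(x, z) \<in> parcs ?S" using xy(1) z(1) by (auto simp: E_def ordered_sum_def)
    then have "(f x, f z) \<in> parcs ?S'" using arc xy(1) z(1) sub(1) by blast
    moreover have "odd (f x)" using xy(1,2) im sub(1) by (auto simp: E'_def)
    moreover have "even (f z)" using xy(3) z(2) by (simp add: E'_def)
    ultimately show False by (simp add: ordered_sum_def)
  qed
  moreover have card_E: "card E = card (pverts G)" "card E' = card (pverts G')"
    unfolding E_def E'_def by (rule bij_betw_same_card[OF bij_betw_even_vertices(2)])+
  moreover have "finite E" "finite E'"
    unfolding E_def E'_def using fin bij_betw_finite[OF bij_betw_even_vertices(2)] by blast+
  moreover have "card (f ` E) = card E"
    using inj sub(1) by (metis card_image inj_on_subset)
  \<comment> \<open>Whichever inclusion holds, nested finite sets of equal size coincide.\<close>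
  ultimately have im_E: "f ` E = E'"
    using card by (metis card_subset_eq finite_imageI)
  have even: "bij_betw f E E'"
    using inj sub(1) im_E by (simp add: bij_betw_def inj_on_subset)
  have odd: "bij_betw f (pverts ?S - E) (pverts ?S' - E')"
    using inj sub(1) im im_E by (simp add: bij_betw_def inj_on_subset inj_on_image_set_diff)
  have parity: "even (f v) \<longleftrightarrow> even v" if "v \<in> pverts ?S" for v
    using bij_betw_apply[OF even, of v] bij_betw_apply[OF odd, of v] that
    by (auto simp: E_def E'_def)
  have "pisomorphic G G'"
    unfolding pisomorphic_def
  \<comment> \<open>The isomorphism restricted to even vertices, carried back to the summands: enter
    the even copy, apply \<open>f\<close>, halve.\<close>
  proof (intro exI[of _ "(\<lambda>v. v div 2) \<circ> (f \<circ> (\<lambda>v. 2 * v))"] conjI ballI)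
    show "bij_betw ((\<lambda>v. v div 2) \<circ> (f \<circ> (\<lambda>v. 2 * v))) (pverts G) (pverts G')"
      using even unfolding E_def E'_def
      by (intro bij_betw_trans[OF bij_betw_trans[OF bij_betw_even_vertices(1)] bij_betw_even_vertices(2)])
    fix u v assume "u \<in> pverts G" "v \<in> pverts G"
    then have uv: "2 * u \<in> pverts ?S" "2 * v \<in> pverts ?S" by (simp_all add: ordered_sum_def)
    have "(u, v) \<in> parcs G \<longleftrightarrow> (2 * u, 2 * v) \<in> parcs ?S" by (simp add: ordered_sum_def)
    also have "\<dots> \<longleftrightarrow> (f (2 * u), f (2 * v)) \<in> parcs ?S'" using arc uv by blast
    also have "\<dots> \<longleftrightarrow> (f (2 * u) div 2, f (2 * v) div 2) \<in> parcs G'"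
      using parity[OF uv(1)] parity[OF uv(2)] by (simp add: ordered_sum_def)
    finally show "(u, v) \<in> parcs G \<longleftrightarrow> (((\<lambda>v. v div 2) \<circ> (f \<circ> (\<lambda>v. 2 * v))) u,
      ((\<lambda>v. v div 2) \<circ> (f \<circ> (\<lambda>v. 2 * v))) v) \<in> parcs G'" by simp
  qed
  moreover have "pisomorphic H H'"
    unfolding pisomorphic_def
  proof (intro exI[of _ "(\<lambda>v. v div 2) \<circ> (f \<circ> (\<lambda>v. 2 * v + 1))"] conjI ballI)
    show "bij_betw ((\<lambda>v. v div 2) \<circ> (f \<circ> (\<lambda>v. 2 * v + 1))) (pverts H) (pverts H')"
      using odd unfolding odds
      by (intro bij_betw_trans[OF bij_betw_trans[OF bij_betw_odd_vertices(1)] bij_betw_odd_vertices(2)])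
    fix u v assume "u \<in> pverts H" "v \<in> pverts H"
    then have uv: "2 * u + 1 \<in> pverts ?S" "2 * v + 1 \<in> pverts ?S" by (simp_all add: ordered_sum_def)
    have "(u, v) \<in> parcs H \<longleftrightarrow> (2 * u + 1, 2 * v + 1) \<in> parcs ?S" by (simp add: ordered_sum_def)
    also have "\<dots> \<longleftrightarrow> (f (2 * u + 1), f (2 * v + 1)) \<in> parcs ?S'" using arc uv by blast
    also have "\<dots> \<longleftrightarrow> (f (2 * u + 1) div 2, f (2 * v + 1) div 2) \<in> parcs H'"
      using parity[OF uv(1)] parity[OF uv(2)] by (simp add: ordered_sum_def)
    finally show "(u, v) \<in> parcs H \<longleftrightarrow> (((\<lambda>v. v div 2) \<circ> (f \<circ> (\<lambda>v. 2 * v + 1))) u,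
      ((\<lambda>v. v div 2) \<circ> (f \<circ> (\<lambda>v. 2 * v + 1))) v) \<in> parcs H'" by simp
  qed
  ultimately show ?thesis by blast
qed

subsection \<open>Counting isomorphism classes\<close>

text \<open>With one fixed representative per class, \<open>h\<close> sends pairs of classes to
  classes of \<open>C\<close>, and \<open>reflects\<close> makes this map injective. Finiteness of
  the target matters because \<open>card\<close> of an infinite set is 0.\<close>

lemma card_quotient_mult_le:
  assumes R: "equiv A R" and S: "equiv B S" and Q: "equiv C Q" and fin: "finite (C // Q)"
    and h: "\<And>a b. a \<in> A \<Longrightarrow> b \<in> B \<Longrightarrow> h a b \<in> C"
    and reflects: "\<And>a b a' b'. \<lbrakk>a \<in> A; b \<in> B; a' \<in> A; b' \<in> B; (h a b, h a' b') \<in> Q\<rbrakk>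
      \<Longrightarrow> (a, a') \<in> R \<and> (b, b') \<in> S"
  shows "card (A // R) * card (B // S) \<le> card (C // Q)"
proof -
  have "\<exists>a. a \<in> A \<and> R `` {a} = X" if "X \<in> A // R" for X
    using that by (auto elim: quotientE)
  then obtain r where r: "\<And>X. X \<in> A // R \<Longrightarrow> r X \<in> A \<and> R `` {r X} = X"
    by metis
  have "\<exists>b. b \<in> B \<and> S `` {b} = Y" if "Y \<in> B // S" for Y
    using that by (auto elim: quotientE)
  then obtain s where s: "\<And>Y. Y \<in> B // S \<Longrightarrow> s Y \<in> B \<and> S `` {s Y} = Y"
    by metis
  let ?g = "\<lambda>(X, Y). Q `` {h (r X) (s Y)}"
  have "inj_on ?g (A // R \<times> B // S)"
  proof (rule inj_onI, clarsimp)
    fix X Y X' Y'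
    assume XY: "X \<in> A // R" "Y \<in> B // S" "X' \<in> A // R" "Y' \<in> B // S"
      and "Q `` {h (r X) (s Y)} = Q `` {h (r X') (s Y')}"
    then have "(h (r X) (s Y), h (r X') (s Y')) \<in> Q"
      using Q h r s by (simp add: eq_equiv_class_iff)
    then have "(r X, r X') \<in> R" "(s Y, s Y') \<in> S"
      using reflects r s XY by blast+
    then show "X = X' \<and> Y = Y'"
      using equiv_class_eq[OF R] equiv_class_eq[OF S] r s XY by metis
  qed
  moreover have "?g ` (A // R \<times> B // S) \<subseteq> C // Q"
    using h r s by (auto intro!: quotientI)
  ultimately have "card (A // R \<times> B // S) \<le> card (C // Q)"
    using fin by (rule card_inj_on_le)
  then show ?thesis by (simp add: card_cartesian_product)
qed

lemma iso_rel_on_iff: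
  assumes "\<And>G. G \<in> A \<Longrightarrow> tournament G"
  shows "(G, H) \<in> iso_rel_on A \<longleftrightarrow> G \<in> A \<and> H \<in> A \<and> pisomorphic G H"
  unfolding iso_rel_on_def using digraph_iso_iff_pisomorphic[OF assms assms] by blast

text \<open>The ordered sum serves as the pairing of classes. Fixing the first size to
  \<open>m\<close> supplies the equal cardinalities from which both summands are recovered.\<close>

lemma unlabelled_count_mult_le:
  assumes tour: "\<And>G. G \<in> P \<Longrightarrow> tournament G"
    and closed: "\<And>G H. G \<in> P \<Longrightarrow> H \<in> P \<Longrightarrow> ordered_sum G H \<in> P"
  shows "unlabelled_count P m * unlabelled_count P n \<le> unlabelled_count P (m + n)"
proof -
  have t: "tournament G" if "G \<in> members_of_size P k" for G k
    using that tour by (simp add: members_of_size_def)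
  have eqv: "equiv (members_of_size P k) (iso_rel_on (members_of_size P k))" for k
    by (intro equiv_iso_rel_on tournament_pair_wf t)
  have fin: "finite (pverts G)" if "G \<in> members_of_size P k" for G k
    using t[OF that] by (rule tournament_finite)
  have iso_iff: "(G, H) \<in> iso_rel_on (members_of_size P k) \<longleftrightarrow>
      G \<in> members_of_size P k \<and> H \<in> members_of_size P k \<and> pisomorphic G H" for G H k
    by (rule iso_rel_on_iff) (rule t)
  show ?thesis
    unfolding unlabelled_count_def
  proof (rule card_quotient_mult_le[OF eqv eqv eqv, where h = ordered_sum])
    show "finite (members_of_size P (m + n) // iso_rel_on (members_of_size P (m + n)))"
      using tour by (rule finite_iso_classes)
    show "ordered_sum G H \<in> members_of_size P (m + n)"
      if "G \<in> members_of_size P m" "H \<in> members_of_size P n" for G H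
      using that fin[OF that(1)] fin[OF that(2)] closed
      by (simp add: members_of_size_def card_pverts_ordered_sum)
    show "(G, G') \<in> iso_rel_on (members_of_size P m) \<and> (H, H') \<in> iso_rel_on (members_of_size P n)"
      if "G \<in> members_of_size P m" "H \<in> members_of_size P n"
        "G' \<in> members_of_size P m" "H' \<in> members_of_size P n"
        "(ordered_sum G H, ordered_sum G' H') \<in> iso_rel_on (members_of_size P (m + n))" for G H G' H'
    proof -
      have "card (pverts G) = card (pverts G')"
        using that by (simp add: members_of_size_def)
      moreover have "pisomorphic (ordered_sum G H) (ordered_sum G' H')"
        using that(5) by (simp add: iso_iff)
      ultimately show ?thesis
        using pisomorphic_ordered_sumD[of G G' H H'] that(1-4) fin
        by (simp add: iso_iff)
    qed
  qed
qed

text \<open>As there are finitely many isomorphism classes, \<open>card\<close> can vanish only on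
  an empty quotient.\<close>

lemma unlabelled_count_pos_iff:
  assumes "\<And>G. G \<in> P \<Longrightarrow> tournament G"
  shows "unlabelled_count P n > 0 \<longleftrightarrow> members_of_size P n \<noteq> {}"
  using finite_iso_classes[OF assms, where n = n]
  by (auto simp: unlabelled_count_def card_gt_0_iff)

theorem theorem28:
  fixes T :: "nat \<Rightarrow> 'a pair_pre_digraph"
  assumes "\<And>i. tournament (T i)"
    and "\<And>i. strongly_connected (with_proj (T i))"
  shows "convergent (\<lambda>n. root n (real (unlabelled_count (tournaments_avoiding T) n))) \<or>
    liminf (\<lambda>n. ereal (root n (real (unlabelled_count (tournaments_avoiding T) n)))) = \<infinity>"
proof -
  let ?P = "tournaments_avoiding T"
  let ?pt = "\<lparr>pverts = {0}, parcs = {}\<rparr> :: nat pair_pre_digraph"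
  note avoid_iff = tournaments_avoiding_iff[of T, OF assms(1)]
  have tour: "tournament G" if "G \<in> ?P" for G
    using that avoid_iff by blast
  \<comment> \<open>Non-emptiness is part of \<open>strongly_connected\<close>; it puts the empty
    tournament into the class.\<close>
  have nonempty: "pverts (T i) \<noteq> {}" for i
    using assms(2)[of i] by (simp add: strongly_connected_def)
  have closed: "ordered_sum G H \<in> ?P" if "G \<in> ?P" "H \<in> ?P" for G H
    using that avoid_iff tournament_ordered_sum embeds_ordered_sum_cases assms by metis
  have pt: "tournament ?pt" by (rule tournamentI) auto
  show ?thesis
  proof (cases "?pt \<in> ?P")
    case True
    let ?e = "\<lparr>pverts = {}, parcs = {}\<rparr> :: nat pair_pre_digraph"
    have "?e \<in> ?P"
      unfolding avoid_iff using nonempty by (auto simp: embeds_def intro: tournamentI)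
    then have "members_of_size ?P 0 \<noteq> {}" by (force simp: members_of_size_def)
    then have "0 < unlabelled_count ?P 0"
      by (simp add: unlabelled_count_pos_iff[OF tour])
    moreover have "members_of_size ?P 1 \<noteq> {}" using True by (force simp: members_of_size_def)
    then have "0 < unlabelled_count ?P 1"
      by (simp add: unlabelled_count_pos_iff[OF tour])
    \<comment> \<open>Starting from size 0, adding one vertex at a time by an ordered sum with the
      point keeps every count positive.\<close>
    ultimately have pos: "0 < unlabelled_count ?P n" for n
    proof (induction n)
      case (Suc n)
      then show ?case
        using unlabelled_count_mult_le[of ?P 1 n, OF tour closed] by (auto intro: less_le_trans[rotated])
    qed
    show ?thesis
    proof (rule supermultiplicative_root_limit)
      show "0 < real (unlabelled_count ?P n)" for n using pos by simp
      show "real (unlabelled_count ?P m) * real (unlabelled_count ?P n) \<le> real (unlabelled_count ?P (m + n))"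
        for m n
        using unlabelled_count_mult_le[of ?P m n, OF tour closed] by (simp flip: of_nat_mult)
    qed
  next
    case False
    then obtain i where "embeds (T i) ?pt"
      using pt avoid_iff by blast
    then obtain f :: "'a \<Rightarrow> nat" where f: "inj_on f (pverts (T i))" "f ` pverts (T i) \<subseteq> {0}"
      by (auto simp: embeds_def)
    \<comment> \<open>A tournament that embeds in a point has only one vertex, so it embeds in every
      non-empty tournament and excludes them all.\<close>
    have single: "u = v" if "u \<in> pverts (T i)" "v \<in> pverts (T i)" for u v
      using f that by (metis image_subset_iff inj_onD singletonD)
    \<comment> \<open>The constant map at \<open>x\<close> respects arcs because neither tournament
      has loops.\<close>
    have emb: "embeds (T i) G" if "x \<in> pverts G" "tournament G" for G :: "nat pair_pre_digraph" and x
      unfolding embeds_def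
    proof (intro exI[of _ "\<lambda>_. x"] conjI ballI)
      show "inj_on (\<lambda>_. x) (pverts (T i))" using single by (blast intro: inj_onI)
      show "(\<lambda>_. x) ` pverts (T i) \<subseteq> pverts G" using that by blast
      show "(u, v) \<in> parcs (T i) \<longleftrightarrow> (x, x) \<in> parcs G"
        if uv: "u \<in> pverts (T i)" "v \<in> pverts (T i)" for u v
        using single[OF uv] tournament_irrefl[OF assms(1)] tournament_irrefl[OF \<open>tournament G\<close>] by simp
    qed
    have "unlabelled_count ?P n = 0" if n: "n > 0" for n
    proof -
      have "members_of_size ?P n = {}"
      proof (rule ccontr)
        assume "members_of_size ?P n \<noteq> {}"
        then obtain G where G: "G \<in> ?P" "card (pverts G) = n"
          by (auto simp: members_of_size_def)
        then have "pverts G \<noteq> {}" using n by auto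
        then obtain x where "x \<in> pverts G" by blast
        then show False using emb G(1) avoid_iff by blast
      qed
      then show ?thesis using unlabelled_count_pos_iff[of ?P n, OF tour] by simp
    qed
    \<comment> \<open>At n = 0 the convention \<open>root 0\<close> = 0 applies, so the sequence is
      constantly 0 even though the empty tournament is counted there.\<close>
    then have "root n (real (unlabelled_count ?P n)) = 0" for n
      by (cases "n = 0") simp_all
    then show ?thesis by (simp add: convergent_const)
  qed
qed

end
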